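(* In the \textsc{oneshot} model, there is a class of DAGs (with $n$ nodes, $n$ arbitrarily large) and a choice of $R$ such that the cost of the pebbling produced by the greedy algorithm (under any of the greedy rules below, and regardless of which red pebbles it chooses to move) satisfies $\textsc{cost}_{\text{greedy}}(R) \geq \widetilde{\Theta}(\sqrt{n}) \cdot \textsc{opt}(R)$, where $\textsc{opt}(R)$ is the minimum cost of a pebbling with $R$ red pebbles.
   Context: Red-blue pebble game on a DAG in the \textsc{oneshot} model: initially no node has a pebble. A pebbling is a finite sequence of steps: (1) replace a blue pebble on a node by a red pebble (cost 1); (2) replace a red pebble by a blue pebble (cost 1); (3) compute: if all in-neighbours (inputs) of a node $v$ carry a red pebble, place a red pebble on $v$ (always allowed for sources), cost 0, at most once per node; (4) delete a pebble (cost 0). At most $R$ red pebbles may be on the DAG at any time; the pebbling is complete when every sink carries a pebble. Cost = number of steps (1) and (2). Greedy algorithm: repeatedly choose, among the not-yet-computed nodes all of whose inputs have already been computed, the next node to compute according to one of the rules: the node with the largest number of red pebbles among its inputs; or the node with the smallest number of blue pebbles among its inputs; or the node with the largest ratio of red-pebbled inputs to inputs; then move red pebbles onto its inputs (by some choice) and compute it. $\widetilde{\Theta}$ hides polylogarithmic factors in $n$. *)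

theory Defs
  imports "Graph_Theory.Pair_Digraph" "HOL-Library.Landau_Symbols"
begin

definition dag :: "'a pair_pre_digraph \<Rightarrow> bool" where
  "dag G \<longleftrightarrow> pair_fin_digraph G \<and> acyclic (parcs G)"

definition inputs :: "'a pair_pre_digraph \<Rightarrow> 'a \<Rightarrow> 'a set" where
  "inputs G v = {u. (u, v) \<in> parcs G}"

definition sinks :: "'a pair_pre_digraph \<Rightarrow> 'a set" where
  "sinks G = {v \<in> pverts G. \<forall>w. (v, w) \<notin> parcs G}"

datatype pebble = Red | Blue

datatype 'a step = Load 'a | Store 'a | Compute 'a | Delete 'a

text \<open>A configuration records the pebble (if any) on each node, and the set of nodes that
  have been computed so far; the latter enforces that no node is computed twice.\<close>

type_synonym 'a config = "('a \<Rightarrow> pebble option) \<times> 'a set"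

definition init_config :: "'a config" where
  "init_config = ((\<lambda>_. None), {})"

definition within_capacity :: "nat \<Rightarrow> ('a \<Rightarrow> pebble option) \<Rightarrow> bool" where
  "within_capacity R p \<longleftrightarrow> card {u. p u = Some Red} \<le> R"

inductive oneshot_step ::
    "'a pair_pre_digraph \<Rightarrow> nat \<Rightarrow> 'a config \<Rightarrow> 'a step \<Rightarrow> 'a config \<Rightarrow> bool"
  for G :: "'a pair_pre_digraph" and R :: nat where
  load: "\<lbrakk>p v = Some Blue; within_capacity R (p(v := Some Red))\<rbrakk>
    \<Longrightarrow> oneshot_step G R (p, C) (Load v) (p(v := Some Red), C)"
| store: "p v = Some Red
    \<Longrightarrow> oneshot_step G R (p, C) (Store v) (p(v := Some Blue), C)"
| compute: "\<lbrakk>v \<in> pverts G; v \<notin> C; \<forall>u \<in> inputs G v. p u = Some Red;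
      within_capacity R (p(v := Some Red))\<rbrakk>
    \<Longrightarrow> oneshot_step G R (p, C) (Compute v) (p(v := Some Red), insert v C)"
| delete: "p v \<noteq> None
    \<Longrightarrow> oneshot_step G R (p, C) (Delete v) (p(v := None), C)"

inductive oneshot_steps ::
    "'a pair_pre_digraph \<Rightarrow> nat \<Rightarrow> 'a config \<Rightarrow> 'a step list \<Rightarrow> 'a config \<Rightarrow> bool"
  for G :: "'a pair_pre_digraph" and R :: nat where
  steps_Nil: "oneshot_steps G R c [] c"
| steps_Cons: "\<lbrakk>oneshot_step G R c s c'; oneshot_steps G R c' ss c''\<rbrakk>
    \<Longrightarrow> oneshot_steps G R c (s # ss) c''"

definition complete_config :: "'a pair_pre_digraph \<Rightarrow> 'a config \<Rightarrow> bool" where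
  "complete_config G c \<longleftrightarrow> (\<forall>v \<in> sinks G. fst c v \<noteq> None)"

definition pebbling :: "'a pair_pre_digraph \<Rightarrow> nat \<Rightarrow> 'a step list \<Rightarrow> bool" where
  "pebbling G R ss \<longleftrightarrow> (\<exists>c. oneshot_steps G R init_config ss c \<and> complete_config G c)"

fun step_cost :: "'a step \<Rightarrow> nat" where
  "step_cost (Load v) = 1"
| "step_cost (Store v) = 1"
| "step_cost (Compute v) = 0"
| "step_cost (Delete v) = 0"

definition cost :: "'a step list \<Rightarrow> nat" where
  "cost ss = sum_list (map step_cost ss)"

text \<open>The minimum is attained whenever a pebbling with \<open>R\<close> red pebbles exists.\<close>

definition opt :: "'a pair_pre_digraph \<Rightarrow> nat \<Rightarrow> nat" where
  "opt G R = Inf {cost ss |ss. pebbling G R ss}"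

datatype greedy_rule = Most_Red_Inputs | Fewest_Blue_Inputs | Largest_Red_Ratio

definition red_inputs :: "'a pair_pre_digraph \<Rightarrow> ('a \<Rightarrow> pebble option) \<Rightarrow> 'a \<Rightarrow> nat" where
  "red_inputs G p v = card {u \<in> inputs G v. p u = Some Red}"

definition blue_inputs :: "'a pair_pre_digraph \<Rightarrow> ('a \<Rightarrow> pebble option) \<Rightarrow> 'a \<Rightarrow> nat" where
  "blue_inputs G p v = card {u \<in> inputs G v. p u = Some Blue}"

text \<open>For a source the ratio is \<open>0 / 0 = 0\<close>.\<close>

definition red_ratio :: "'a pair_pre_digraph \<Rightarrow> ('a \<Rightarrow> pebble option) \<Rightarrow> 'a \<Rightarrow> real" where
  "red_ratio G p v = real (red_inputs G p v) / real (card (inputs G v))"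

text \<open>\<open>weakly_preferred rule G p v w\<close>: the rule ranks \<open>v\<close> at least as high as \<open>w\<close>.\<close>

fun weakly_preferred ::
    "greedy_rule \<Rightarrow> 'a pair_pre_digraph \<Rightarrow> ('a \<Rightarrow> pebble option) \<Rightarrow> 'a \<Rightarrow> 'a \<Rightarrow> bool" where
  "weakly_preferred Most_Red_Inputs G p v w \<longleftrightarrow> red_inputs G p w \<le> red_inputs G p v"
| "weakly_preferred Fewest_Blue_Inputs G p v w \<longleftrightarrow> blue_inputs G p v \<le> blue_inputs G p w"
| "weakly_preferred Largest_Red_Ratio G p v w \<longleftrightarrow> red_ratio G p w \<le> red_ratio G p v"

definition candidates :: "'a pair_pre_digraph \<Rightarrow> 'a set \<Rightarrow> 'a set" where
  "candidates G C = {v \<in> pverts G. v \<notin> C \<and> inputs G v \<subseteq> C}"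

text \<open>Ties may be broken arbitrarily.\<close>

definition greedy_choice ::
    "greedy_rule \<Rightarrow> 'a pair_pre_digraph \<Rightarrow> 'a config \<Rightarrow> 'a \<Rightarrow> bool" where
  "greedy_choice rule G c v \<longleftrightarrow>
     v \<in> candidates G (snd c) \<and> (\<forall>w \<in> candidates G (snd c). weakly_preferred rule G (fst c) v w)"

text \<open>The steps by which red pebbles may be moved onto the inputs of the chosen node \<open>v\<close>:
  inputs of \<open>v\<close> are loaded, and arbitrary other pebbles are stored or deleted to make room.\<close>

definition fetch_steps :: "'a pair_pre_digraph \<Rightarrow> 'a \<Rightarrow> 'a step set" where
  "fetch_steps G v =
     {Load u |u. u \<in> inputs G v} \<union> {Store u |u. u \<notin> inputs G v} \<union> {Delete u |u. u \<notin> inputs G v}"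

inductive greedy_steps ::
    "greedy_rule \<Rightarrow> 'a pair_pre_digraph \<Rightarrow> nat \<Rightarrow> 'a config \<Rightarrow> 'a step list \<Rightarrow> 'a config \<Rightarrow> bool"
  for rule :: greedy_rule and G :: "'a pair_pre_digraph" and R :: nat where
  greedy_Nil: "greedy_steps rule G R c [] c"
| greedy_phase: "\<lbrakk>greedy_choice rule G c v; set ss \<subseteq> fetch_steps G v;
      oneshot_steps G R c (ss @ [Compute v]) c'; greedy_steps rule G R c' ss' c''\<rbrakk>
    \<Longrightarrow> greedy_steps rule G R c ((ss @ [Compute v]) @ ss') c''"

text \<open>The possible outputs of the greedy algorithm, over all ways of breaking ties and of
  choosing the red pebbles to move.\<close>

definition greedy_pebbling ::
    "greedy_rule \<Rightarrow> 'a pair_pre_digraph \<Rightarrow> nat \<Rightarrow> 'a step list \<Rightarrow> bool" where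
  "greedy_pebbling rule G R ss \<longleftrightarrow>
     (\<exists>c. greedy_steps rule G R init_config ss c \<and> complete_config G c)"

text \<open>The Landau symbols compare absolute values, so nonnegativity is required separately.\<close>

definition soft_Theta :: "(nat \<Rightarrow> real) \<Rightarrow> (nat \<Rightarrow> real) set" where
  "soft_Theta g = {f. (\<forall>\<^sub>F n in at_top. 0 \<le> f n) \<and>
     (\<exists>k::nat. f \<in> O(\<lambda>n. g n * ln (real n) ^ k) \<and> f \<in> \<Omega>(\<lambda>n. g n / ln (real n) ^ k))}"

end

theory Submission
  imports Defs
begin

text \<open>Take a path whose every node depends on the \<open>m\<close> preceding ones, and \<open>m + 1\<close> red
  pebbles: computing a path node leaves red exactly that node and its inputs. A trap node depends
  on node \<open>0\<close> and on the nodes \<open>3, \<dots>, m + 1\<close>. When it becomes available, node \<open>0\<close> has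
  already been evicted, so the next path node, all of whose inputs are red, always beats it under
  every greedy rule. Greedy therefore finishes the path first, and by then every input of the trap
  node is blue, which costs \<open>m\<close> loads. Computing the trap node at once keeps the total cost
  at \<open>5\<close>, so the ratio is even linear in the number \<open>2 * m + 4\<close> of nodes.\<close>

section \<open>Red pebbles and runs in general\<close>

definition reds :: "('a \<Rightarrow> pebble option) \<Rightarrow> 'a set" where
  "reds p = {u. p u = Some Red}"

lemma mem_reds [simp]: "u \<in> reds p \<longleftrightarrow> p u = Some Red"
  by (simp add: reds_def)

lemma reds_eq_iff: "reds p = A \<Longrightarrow> p u = Some Red \<longleftrightarrow> u \<in> A"
  by auto

lemma finite_reds:
  assumes "{u. p u \<noteq> None} \<subseteq> C" "finite C"
  shows "finite (reds p)"
proof -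
  have "reds p \<subseteq> {u. p u \<noteq> None}" by auto
  with assms show ?thesis by (meson finite_subset)
qed

lemma blue_if_not_red: "p u \<noteq> None \<Longrightarrow> p u \<noteq> Some Red \<Longrightarrow> p u = Some Blue"
  by (metis (full_types) not_None_eq pebble.exhaust)

lemma within_capacity_reds: "within_capacity R p \<longleftrightarrow> card (reds p) \<le> R"
  by (simp add: within_capacity_def reds_def)

lemma reds_upd:
  "reds (p(v := Some Red)) = insert v (reds p)"
  "reds (p(v := Some Blue)) = reds p - {v}"
  "reds (p(v := None)) = reds p - {v}"
  by (auto simp: reds_def)

lemma cost_Nil [simp]: "cost [] = 0"
  and cost_Cons [simp]: "cost (s # ss) = step_cost s + cost ss"
  and cost_append [simp]: "cost (ss @ ss') = cost ss + cost ss'"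
  by (simp_all add: cost_def)

lemma oneshot_steps_append:
  "oneshot_steps G R c ss c' \<Longrightarrow> oneshot_steps G R c' ss' c'' \<Longrightarrow> oneshot_steps G R c (ss @ ss') c''"
  by (induction rule: oneshot_steps.induct) (auto intro: oneshot_steps.intros)

lemma oneshot_steps_single: "oneshot_step G R c s c' \<Longrightarrow> oneshot_steps G R c [s] c'"
  by (auto intro: oneshot_steps.intros)

lemma oneshot_steps_snocE:
  assumes "oneshot_steps G R c (ss @ [s]) c''"
  obtains c' where "oneshot_steps G R c ss c'" "oneshot_step G R c' s c''"
proof -
  have "\<exists>c'. oneshot_steps G R c ss c' \<and> oneshot_step G R c' s c''"
    using assms
  proof (induction ss arbitrary: c)
    case Nil
    then show ?case by (auto elim!: oneshot_steps.cases intro: oneshot_steps.intros)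
  next
    case (Cons a ss)
    from Cons.prems obtain d where d: "oneshot_step G R c a d" "oneshot_steps G R d (ss @ [s]) c''"
      by (auto elim: oneshot_steps.cases)
    with Cons.IH show ?case by (meson oneshot_steps.steps_Cons)
  qed
  with that show thesis by blast
qed

lemma greedy_steps_append:
  "greedy_steps rule G R c ss c' \<Longrightarrow> greedy_steps rule G R c' ss' c'' \<Longrightarrow>
    greedy_steps rule G R c (ss @ ss') c''"
proof (induction rule: greedy_steps.induct)
  case (greedy_phase c v ss c' ss'' c''')
  then show ?case using greedy_steps.greedy_phase[of rule G c v ss R c' "ss'' @ ss'" c''] by simp
qed simp

lemma greedy_steps_phase:
  "greedy_choice rule G c v \<Longrightarrow> set ss \<subseteq> fetch_steps G v \<Longrightarrow>
    oneshot_steps G R c (ss @ [Compute v]) c' \<Longrightarrow> greedy_steps rule G R c (ss @ [Compute v]) c'"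
  using greedy_steps.greedy_phase[of rule G c v ss R c' "[]" c', OF _ _ _ greedy_steps.greedy_Nil]
  by simp

text \<open>Without computations a node turns red only by a \<open>Load\<close>, and each
  \<open>Load\<close> costs 1, so the newly red nodes are paid for one by one. This turns statements
  about red sets before and after a fetch into cost bounds.\<close>

lemma oneshot_steps_no_Compute:
  assumes "oneshot_steps G R c ss c'" "\<And>v. Compute v \<notin> set ss"
  shows "snd c' = snd c"
    and "{u. fst c' u \<noteq> None} \<subseteq> {u. fst c u \<noteq> None}"
    and "card (reds (fst c') - reds (fst c)) \<le> cost ss"
    and "finite (reds (fst c') - reds (fst c))"
proof -
  have "snd c' = snd c \<and> {u. fst c' u \<noteq> None} \<subseteq> {u. fst c u \<noteq> None} \<and>
      reds (fst c') - reds (fst c) \<subseteq> {u. Load u \<in> set ss}"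
    using assms
  proof (induction rule: oneshot_steps.induct)
    case (steps_Cons c s c' ss c'')
    have 1: "snd c' = snd c \<and> {u. fst c' u \<noteq> None} \<subseteq> {u. fst c u \<noteq> None} \<and>
      reds (fst c') - reds (fst c) \<subseteq> {u. Load u = s}"
      using steps_Cons.hyps(1) steps_Cons.prems
      by cases (auto split: if_splits)
    have 2: "snd c'' = snd c' \<and> {u. fst c'' u \<noteq> None} \<subseteq> {u. fst c' u \<noteq> None} \<and>
      reds (fst c'') - reds (fst c') \<subseteq> {u. Load u \<in> set ss}"
      using steps_Cons by auto
    show ?case
    proof (intro conjI)
      show "snd c'' = snd c" using 1 2 by simp
      show "{u. fst c'' u \<noteq> None} \<subseteq> {u. fst c u \<noteq> None}" using 1 2 by blast
      have "reds (fst c'') - reds (fst c) \<subseteq> {u. Load u = s} \<union> {u. Load u \<in> set ss}"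
        using 1 2 by blast
      then show "reds (fst c'') - reds (fst c) \<subseteq> {u. Load u \<in> set (s # ss)}" by auto
    qed
  qed simp
  moreover have "finite {u. Load u \<in> set ss} \<and> card {u. Load u \<in> set ss} \<le> cost ss"
    for ss :: "'a step list"
  proof (induction ss)
    case (Cons s ss)
    show ?case
    proof (cases s)
      case (Load v)
      then have "{u. Load u \<in> set (s # ss)} = insert v {u. Load u \<in> set ss}" by auto
      then show ?thesis using Cons Load by (simp add: card_insert_if)
    qed (use Cons in auto)
  qed simp
  ultimately show "snd c' = snd c" "{u. fst c' u \<noteq> None} \<subseteq> {u. fst c u \<noteq> None}"
    "card (reds (fst c') - reds (fst c)) \<le> cost ss" "finite (reds (fst c') - reds (fst c))"
    by (auto intro: order_trans[OF card_mono] finite_subset)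
qed

lemma steps_Stores:
  assumes "distinct xs" "set xs \<subseteq> reds p"
  shows "oneshot_steps G R (p, C) (map Store xs) (\<lambda>u. if u \<in> set xs then Some Blue else p u, C)"
  using assms
proof (induction xs arbitrary: p)
  case (Cons x xs)
  let ?p = "p(x := Some Blue)"
  have "oneshot_steps G R (?p, C) (map Store xs) (\<lambda>u. if u \<in> set xs then Some Blue else ?p u, C)"
    using Cons by (intro Cons.IH) auto
  moreover have "(\<lambda>u. if u \<in> set xs then Some Blue else ?p u) =
      (\<lambda>u. if u \<in> set (x # xs) then Some Blue else p u)"
    by auto
  ultimately show ?case
    using Cons.prems by (auto intro!: steps_Cons oneshot_step.store)
qed (simp add: steps_Nil)

lemma steps_Loads:
  assumes "distinct xs" "\<And>u. u \<in> set xs \<Longrightarrow> p u = Some Blue"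
    and "finite (reds p)" "card (reds p) + length xs \<le> R"
  shows "oneshot_steps G R (p, C) (map Load xs) (\<lambda>u. if u \<in> set xs then Some Red else p u, C)"
  using assms
proof (induction xs arbitrary: p)
  case (Cons x xs)
  let ?p = "p(x := Some Red)"
  have c: "finite (reds ?p)" "card (reds ?p) \<le> Suc (card (reds p))"
    using Cons.prems by (auto simp: reds_upd card_insert_if)
  have "oneshot_steps G R (?p, C) (map Load xs) (\<lambda>u. if u \<in> set xs then Some Red else ?p u, C)"
    using Cons.prems c by (intro Cons.IH) (auto simp del: fun_upd_apply, auto)
  moreover have "(\<lambda>u. if u \<in> set xs then Some Red else ?p u) =
      (\<lambda>u. if u \<in> set (x # xs) then Some Red else p u)"
    by auto
  moreover have "within_capacity R ?p"
    using Cons.prems c by (simp add: within_capacity_reds)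
  ultimately show ?case
    using Cons.prems by (auto intro!: steps_Cons oneshot_step.load)
qed (simp add: steps_Nil)

section \<open>The DAG\<close>

text \<open>The nodes up to \<open>2 * m + 2\<close> form the path; \<open>2 * m + 3\<close> is the trap node.\<close>

definition trap :: "nat \<Rightarrow> nat pair_pre_digraph" where
  "trap m = \<lparr>pverts = {..2 * m + 3},
     parcs = {(j, i). j < i \<and> i \<le> j + m \<and> i \<le> 2 * m + 2} \<union> insert 0 {3..m + 1} \<times> {2 * m + 3}\<rparr>"

lemma pverts_trap [simp]: "pverts (trap m) = {..2 * m + 3}"
  by (simp add: trap_def)

text \<open>Subtraction truncates at 0, so for \<open>i \<le> m\<close> this is the set of all
  predecessors; the indegree reaches \<open>m\<close> from node \<open>m\<close> on.\<close>

lemma inputs_path: "i \<le> 2 * m + 2 \<Longrightarrow> inputs (trap m) i = {i - m..<i}"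
  by (auto simp: inputs_def trap_def)

lemma inputs_trap: "inputs (trap m) (2 * m + 3) = insert 0 {3..m + 1}"
  by (auto simp: inputs_def trap_def)

lemma sinks_trap: "2 \<le> m \<Longrightarrow> sinks (trap m) = {2 * m + 2, 2 * m + 3}"
proof -
  assume m: "2 \<le> m"
  have "(v, Suc v) \<in> parcs (trap m)" if "v < 2 * m + 2" for v
    using that m by (auto simp: trap_def)
  then have "2 * m + 2 \<le> v" if "v \<in> sinks (trap m)" for v
    using that by (auto simp: sinks_def not_less[symmetric])
  then have "sinks (trap m) \<subseteq> {2 * m + 2, 2 * m + 3}"
    by (fastforce simp: sinks_def)
  moreover have "{2 * m + 2, 2 * m + 3} \<subseteq> sinks (trap m)"
    using m by (auto simp: sinks_def trap_def)
  ultimately show ?thesis by blast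
qed

lemma dag_trap: "dag (trap m)"
proof -
  have arcs: "parcs (trap m) \<subseteq> {..2 * m + 3} \<times> {..2 * m + 3}"
    by (auto simp: trap_def)
  have less: "parcs (trap m) \<subseteq> {(x, y). x < y}"
    by (auto simp: trap_def)
  have "finite (parcs (trap m))"
    by (rule finite_subset[OF arcs]) simp
  then have "pair_fin_digraph (trap m)"
    using arcs by unfold_locales auto
  moreover have "acyclic (parcs (trap m))"
    using less by (meson acyclic_subset wf_acyclic wf_less)
  ultimately show ?thesis by (simp add: dag_def)
qed

text \<open>A path node beyond \<open>i\<close> still lacks its direct predecessor, and the trap
  node waits for its largest input \<open>m + 1\<close>. Hence the algorithm never has more than two
  nodes to choose from while the computed set is an initial segment.\<close>

lemma candidates_path:
  assumes "2 \<le> m" "i \<le> 2 * m + 3"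
  shows "candidates (trap m) {..<i} =
    (if i \<le> 2 * m + 2 then {i} else {}) \<union> (if m + 2 \<le> i then {2 * m + 3} else {})"
proof (rule set_eqI)
  fix v
  consider "v < i" | "v = i" "i \<le> 2 * m + 2" | "i < v" "v \<le> 2 * m + 2" | "v = 2 * m + 3" | "v > 2 * m + 3"
    using assms by linarith
  then show "v \<in> candidates (trap m) {..<i} \<longleftrightarrow>
    v \<in> (if i \<le> 2 * m + 2 then {i} else {}) \<union> (if m + 2 \<le> i then {2 * m + 3} else {})"
  proof cases
    case 2
    then show ?thesis by (auto simp: candidates_def inputs_path)
  next
    case 3
    then have "v - 1 \<in> inputs (trap m) v" using \<open>2 \<le> m\<close> by (auto simp: inputs_path)
    then show ?thesis using 3 by (auto simp: candidates_def)
  next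
    case 4
    have "insert 0 {3..m + 1} \<subseteq> {..<i} \<longleftrightarrow> m + 2 \<le> i"
      using assms by (auto simp: subset_iff dest: spec[of _ "m + 1"])
    then show ?thesis
      unfolding 4 using assms by (auto simp: candidates_def inputs_trap simp del: insert_subset)
  qed (use assms in \<open>auto simp: candidates_def\<close>)
qed


section \<open>Lower bound for the greedy algorithm\<close>

text \<open>Only \<open>Compute\<close> puts a pebble on an empty node. Finiteness is carried along
  because \<open>card\<close> of an infinite set is 0, which would make the capacity bound
  vacuous.\<close>

lemma oneshot_steps_pebbled_computed:
  assumes "oneshot_steps G R c ss c'" "{u. fst c u \<noteq> None} \<subseteq> snd c" "finite (snd c)"
  shows "{u. fst c' u \<noteq> None} \<subseteq> snd c' \<and> finite (snd c')"
  using assms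
proof (induction rule: oneshot_steps.induct)
  case (steps_Cons c s c' ss c'')
  from steps_Cons.hyps(1) steps_Cons.prems have "{u. fst c' u \<noteq> None} \<subseteq> snd c' \<and> finite (snd c')"
    by cases (auto split: if_splits)
  with steps_Cons.IH show ?case by blast
qed simp

text \<open>Leaving out nodes 1 and 2 gives the trap node the same indegree as the path nodes from
  \<open>m\<close> on, so the ratio rule compares fractions with equal denominators.\<close>

lemma card_inputs_trap: "2 \<le> m \<Longrightarrow> card (inputs (trap m) (2 * m + 3)) = m"
  by (simp add: inputs_trap)

text \<open>Tightness of the capacity: computing a node of indegree \<open>R - 1\<close> evicts everything else.\<close>

lemma reds_after_Compute:
  assumes "oneshot_step G R (p, C) (Compute v) (p', C')" "finite (reds p')"
    and "R \<le> card (insert v (inputs G v))"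
  shows "reds p' = insert v (inputs G v)"
  using assms(1)
proof cases
  case compute
  then have "insert v (inputs G v) \<subseteq> reds p'" "card (reds p') \<le> R"
    by (auto simp: within_capacity_reds)
  then show ?thesis using assms(2,3) by (metis card_seteq order_trans)
qed

text \<open>Node \<open>i\<close> has all \<open>m\<close> inputs red, while one of the
  \<open>m\<close> inputs of the trap node is blue, so \<open>i\<close> wins strictly under each
  rule. Node 0 is assumed blue and not merely without a red pebble, since
  \<open>Fewest_Blue_Inputs\<close> does not count empty inputs.\<close>

lemma trap_not_preferred:
  assumes "2 \<le> m" "m + 2 \<le> i" "i \<le> 2 * m + 2" and red: "reds p = {i - m - 1..<i}"
    and blue: "p 0 = Some Blue"
  shows "\<not> weakly_preferred rule (trap m) p (2 * m + 3) i"
proof -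
  have all_red: "p u = Some Red" if "u \<in> inputs (trap m) i" for u
    using that assms by (auto simp: reds_eq_iff[OF red] inputs_path)
  have "card (inputs (trap m) i) = m"
    using assms by (simp add: inputs_path)
  then have ri: "red_inputs (trap m) p i = m"
    using all_red by (metis (mono_tags, lifting) Collect_cong Collect_mem_eq red_inputs_def)
  have "{u \<in> inputs (trap m) i. p u = Some Blue} = {}"
    using all_red by auto
  then have bi: "blue_inputs (trap m) p i = 0"
    by (metis blue_inputs_def card.empty)
  have fin: "finite (inputs (trap m) (2 * m + 3))"
    by (simp add: inputs_trap)
  have "0 \<in> inputs (trap m) (2 * m + 3)" "p 0 \<noteq> Some Red"
    using blue by (simp_all add: inputs_trap)
  then have "red_inputs (trap m) p (2 * m + 3) < card (inputs (trap m) (2 * m + 3))"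
    unfolding red_inputs_def by (intro psubset_card_mono fin) blast
  then have rt: "red_inputs (trap m) p (2 * m + 3) < m"
    using assms by (simp add: card_inputs_trap)
  have "0 \<in> {u \<in> inputs (trap m) (2 * m + 3). p u = Some Blue}"
    using blue by (simp add: inputs_trap)
  then have bt: "0 < blue_inputs (trap m) p (2 * m + 3)"
    unfolding blue_inputs_def using fin by (subst card_gt_0_iff) auto
  show ?thesis
    using ri bi rt bt card_inputs_trap[of m] \<open>card (inputs (trap m) i) = m\<close> \<open>2 \<le> m\<close>
    by (cases rule) (auto simp: red_ratio_def)
qed

lemma fetch_steps_no_Compute: "set ss \<subseteq> fetch_steps G v \<Longrightarrow> Compute w \<notin> set ss"
  by (auto simp: fetch_steps_def)

text \<open>Induction over the phases, as long as the computed nodes form an initial segment and,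
  once \<open>m\<close> is computed, the red nodes are exactly the last \<open>m + 1\<close> of
  them. The phase that computes the trap node must come after the whole path and already pays
  \<open>m\<close>.\<close>

lemma greedy_cost_from_path:
  assumes "greedy_steps rule (trap m) (m + 1) c ss c'" "2 \<le> m"
    and "i \<le> 2 * m + 3" "snd c = {..<i}" "{u. fst c u \<noteq> None} \<subseteq> snd c"
    and "m < i \<longrightarrow> reds (fst c) = {i - m - 1..<i}"
    and "fst c' (2 * m + 3) \<noteq> None"
  shows "m \<le> cost ss"
  using assms
proof (induction arbitrary: i rule: greedy_steps.induct)
  case (greedy_Nil c)
  then show ?case by auto
next
  case (greedy_phase c v ss c' ss' c'')
  note fetch = fetch_steps_no_Compute[OF greedy_phase.hyps(2)]
  obtain d where d: "oneshot_steps (trap m) (m + 1) c ss d"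
    and cv: "oneshot_step (trap m) (m + 1) d (Compute v) c'"
    using greedy_phase.hyps(3) by (rule oneshot_steps_snocE)
  note nc = oneshot_steps_no_Compute[OF d fetch]
  have d_red: "inputs (trap m) v \<subseteq> reds (fst d)"
    using cv by cases auto
  have c': "{u. fst c' u \<noteq> None} \<subseteq> snd c' \<and> finite (snd c')"
    using greedy_phase.prems by (intro oneshot_steps_pebbled_computed[OF greedy_phase.hyps(3)]) auto
  have snd_c': "snd c' = insert v {..<i}"
    using cv nc(1) greedy_phase.prems by cases auto
  have fin: "finite (reds (fst c'))"
    using c' finite_reds by blast
  have "v \<in> candidates (trap m) {..<i}"
    using greedy_phase.hyps(1) greedy_phase.prems by (simp add: greedy_choice_def)
  then consider "v = i" "i \<le> 2 * m + 2" | "v = 2 * m + 3" "m + 2 \<le> i"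
    using greedy_phase.prems by (auto simp: candidates_path split: if_splits)
  then show ?case
  proof cases
    case 1
    \<comment> \<open>For \<open>i \<ge> m\<close> the node has \<open>m\<close> inputs, so together
      with it they fill the capacity \<open>m + 1\<close>.\<close>
    have "reds (fst c') = {Suc i - m - 1..<Suc i}" if "m < Suc i"
    proof -
      have eq: "insert v (inputs (trap m) v) = {Suc i - m - 1..<Suc i}"
        using 1 that by (auto simp: inputs_path)
      show ?thesis
        unfolding eq[symmetric]
      proof (rule reds_after_Compute)
        show "oneshot_step (trap m) (m + 1) (fst d, snd d) (Compute v) (fst c', snd c')"
          using cv by simp
        show "m + 1 \<le> card (insert v (inputs (trap m) v))"
          unfolding eq using that by simp
      qed (rule fin)
    qed
    moreover have "snd c' = {..<Suc i}"
      using snd_c' 1 by (simp add: lessThan_Suc)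
    ultimately have "m \<le> cost ss'"
      using 1 c' greedy_phase.prems by (intro greedy_phase.IH[of "Suc i"]) auto
    then show ?thesis by simp
  next
    case 2
    \<comment> \<open>Fetching never pebbles an empty node, so inputs that are red after the fetch
      carried some pebble before it.\<close>
    have nonblank: "fst c u \<noteq> None" if "u \<in> inputs (trap m) v" for u
      using that d_red nc(2) by (metis (mono_tags, lifting) mem_Collect_eq mem_reds option.distinct(1) subsetD)
    show ?thesis
    proof (cases "i = 2 * m + 3")
      case True
      \<comment> \<open>With the path complete, the red window starts just above the largest input
        \<open>m + 1\<close> of the trap node, so all \<open>m\<close> inputs have to be
        loaded.\<close>
      have "reds (fst c) = {m + 2..<i}"
        using greedy_phase.prems(5) True by simp
      moreover have "inputs (trap m) v \<inter> {m + 2..<i} = {}"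
        using 2 by (auto simp: inputs_trap)
      ultimately have "inputs (trap m) v \<subseteq> reds (fst d) - reds (fst c)"
        using d_red by blast
      then have "card (inputs (trap m) v) \<le> card (reds (fst d) - reds (fst c))"
        by (rule card_mono[OF nc(4)])
      then have "m \<le> cost ss"
        using nc(3) card_inputs_trap[of m] 2 \<open>2 \<le> m\<close> by simp
      then show ?thesis by simp
    next
      case False
      have red: "reds (fst c) = {i - m - 1..<i}"
        using greedy_phase.prems 2 by simp
      \<comment> \<open>The window starts at \<open>i - m - 1 \<ge> 1\<close>; node 0 is thus
        pebbled but not red, and choosing the trap node would violate the rule.\<close>
      then have "0 \<notin> reds (fst c)" using 2 by simp
      moreover have "fst c 0 \<noteq> None"
        using nonblank 2 by (simp add: inputs_trap)
      ultimately have "fst c 0 = Some Blue"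
        by (intro blue_if_not_red) auto
      then have "\<not> weakly_preferred rule (trap m) (fst c) v i"
        using red 2 False greedy_phase.prems by (simp add: trap_not_preferred)
      moreover have "i \<in> candidates (trap m) (snd c)"
        using False greedy_phase.prems by (simp add: candidates_path)
      ultimately show ?thesis
        using greedy_phase.hyps(1) by (simp add: greedy_choice_def)
    qed
  qed
qed

lemma greedy_cost_ge:
  assumes "greedy_pebbling rule (trap m) (m + 1) ss" "2 \<le> m"
  shows "m \<le> cost ss"
proof -
  obtain c where c: "greedy_steps rule (trap m) (m + 1) init_config ss c"
    and "complete_config (trap m) c"
    using assms by (auto simp: greedy_pebbling_def)
  then have "fst c (2 * m + 3) \<noteq> None"
    using assms by (simp add: complete_config_def sinks_trap)
  then show ?thesis
    using assms by (intro greedy_cost_from_path[OF c, of 0]) (auto simp: init_config_def)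
qed

section \<open>Existence of greedy pebblings\<close>

text \<open>Every rule compares numerical scores, so a node that is not weakly preferred is beaten
  by the other one.\<close>

lemma weakly_preferred_linear:
  "weakly_preferred rule G p v w \<or> weakly_preferred rule G p w v"
  by (cases rule) auto

text \<open>The next path node is the only candidate at first and beats the trap node later. Evicted
  nodes are stored rather than deleted, so that node 0 is blue in that comparison and every input of
  the trap node can be reloaded at the end.\<close>

lemma greedy_path_run:
  assumes "2 \<le> m" "i \<le> 2 * m + 3"
  shows "\<exists>ss p. greedy_steps rule (trap m) (m + 1) init_config ss (p, {..<i}) \<and>
    reds p = {i - m - 1..<i} \<and> (\<forall>u<i. p u \<noteq> None)"
  using assms(2)
proof (induction i)
  case 0
  show ?case
    by (rule exI[of _ "[]"], rule exI[of _ "\<lambda>_. None"]) (auto simp: init_config_def intro: greedy_Nil)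
next
  case (Suc i)
  then obtain ss p where run: "greedy_steps rule (trap m) (m + 1) init_config ss (p, {..<i})"
    and red: "reds p = {i - m - 1..<i}" and pebbled: "\<forall>u<i. p u \<noteq> None"
    by auto
  \<comment> \<open>The list holds just \<open>i - m - 1\<close> if \<open>m < i\<close> and is
    empty otherwise; the filter keeps truncated subtraction from evicting node 0 too early.\<close>
  let ?G = "trap m" and ?evict = "filter (\<lambda>u. u + m < i) [i - m - 1..<i]"
  define q where "q = (\<lambda>u. if u \<in> set ?evict then Some Blue else p u)"
  have stores: "oneshot_steps ?G (m + 1) (p, {..<i}) (map Store ?evict) (q, {..<i})"
    unfolding q_def by (rule steps_Stores) (auto simp: red)
  have red_q: "reds q = {i - m..<i}"
  proof (rule set_eqI)
    fix u
    show "u \<in> reds q \<longleftrightarrow> u \<in> {i - m..<i}"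
      using reds_eq_iff[OF red, of u] by (auto simp: q_def)
  qed
  have "oneshot_step ?G (m + 1) (q, {..<i}) (Compute i) (q(i := Some Red), insert i {..<i})"
  proof (rule oneshot_step.compute)
    show "\<forall>u\<in>inputs ?G i. q u = Some Red"
      using Suc.prems by (auto simp: inputs_path reds_eq_iff[OF red_q])
    show "within_capacity (m + 1) (q(i := Some Red))"
      by (simp add: within_capacity_reds reds_upd red_q)
  qed (use Suc.prems in auto)
  then have "oneshot_steps ?G (m + 1) (p, {..<i}) (map Store ?evict @ [Compute i])
      (q(i := Some Red), {..<Suc i})"
    using stores by (simp add: oneshot_steps_append oneshot_steps_single lessThan_Suc)
  moreover have "set (map Store ?evict) \<subseteq> fetch_steps ?G i"
    using Suc.prems by (auto simp: fetch_steps_def inputs_path)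
  moreover have "weakly_preferred rule ?G p i v" if "v \<in> candidates ?G {..<i}" for v
  proof (cases "v = i")
    case True
    then show ?thesis using weakly_preferred_linear by metis
  next
    case False
    then have v: "v = 2 * m + 3" "m + 2 \<le> i"
      using that Suc.prems assms by (auto simp: candidates_path split: if_splits)
    have "0 \<notin> reds p" using v red by simp
    moreover have "p 0 \<noteq> None" using pebbled v by simp
    ultimately have "p 0 = Some Blue"
      by (intro blue_if_not_red) auto
    then show ?thesis
      using trap_not_preferred[of m i p rule] weakly_preferred_linear v red Suc.prems assms
      by fastforce
  qed
  then have "greedy_choice rule ?G (p, {..<i}) i"
    using Suc.prems assms by (simp add: greedy_choice_def candidates_path)
  ultimately have "greedy_steps rule ?G (m + 1) init_config
      (ss @ (map Store ?evict @ [Compute i])) (q(i := Some Red), {..<Suc i})"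
    using run by (blast intro: greedy_steps_append greedy_steps_phase)
  moreover have "reds (q(i := Some Red)) = {Suc i - m - 1..<Suc i}"
    unfolding reds_upd red_q by auto
  moreover have "\<forall>u<Suc i. (q(i := Some Red)) u \<noteq> None"
    using pebbled by (auto simp: q_def less_Suc_eq)
  ultimately show ?case by blast
qed

text \<open>After the path only the trap node is left. Storing the entire red window and loading its
  \<open>m\<close> inputs leaves one red pebble for the node itself.\<close>

lemma ex_greedy_pebbling:
  assumes "2 \<le> m"
  shows "\<exists>ss. greedy_pebbling rule (trap m) (m + 1) ss"
proof -
  let ?G = "trap m" and ?g = "2 * m + 3"
  obtain ss p where run: "greedy_steps rule ?G (m + 1) init_config ss (p, {..<?g})"
    and red: "reds p = {?g - m - 1..<?g}" and pebbled: "\<forall>u<?g. p u \<noteq> None"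
    using greedy_path_run[OF assms, of ?g rule] by blast
  let ?window = "[m + 2..<?g]" and ?inputs = "0 # [3..<m + 2]"
  define q where "q = (\<lambda>u. if u \<in> set ?window then Some Blue else p u)"
  define r where "r = (\<lambda>u. if u \<in> set ?inputs then Some Red else q u)"
  let ?fetch = "map Store ?window @ map Load ?inputs"
  have red_q: "reds q = {}"
    using red by (auto simp: q_def reds_def set_eq_iff)
  have "oneshot_steps ?G (m + 1) (p, {..<?g}) (map Store ?window) (q, {..<?g})"
    unfolding q_def by (rule steps_Stores) (auto simp: red)
  moreover have "oneshot_steps ?G (m + 1) (q, {..<?g}) (map Load ?inputs) (r, {..<?g})"
    unfolding r_def
  proof (rule steps_Loads)
    fix u assume "u \<in> set ?inputs"
    then have "q u \<noteq> None" using pebbled by (auto simp: q_def)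
    moreover have "q u \<noteq> Some Red" by (simp add: reds_eq_iff[OF red_q])
    ultimately show "q u = Some Blue" by (rule blue_if_not_red)
  qed (use assms in \<open>auto simp: red_q\<close>)
  moreover have "oneshot_step ?G (m + 1) (r, {..<?g}) (Compute ?g) (r(?g := Some Red), insert ?g {..<?g})"
  proof (rule oneshot_step.compute)
    have "reds r = set ?inputs"
      using red_q by (auto simp: r_def reds_def set_eq_iff)
    moreover have "card (set ?inputs) = m"
      using assms by (subst distinct_card) auto
    ultimately show "within_capacity (m + 1) (r(?g := Some Red))"
      by (simp add: within_capacity_reds reds_upd card_insert_if)
  qed (auto simp: inputs_trap r_def)
  ultimately have "oneshot_steps ?G (m + 1) (p, {..<?g}) (?fetch @ [Compute ?g])
      (r(?g := Some Red), insert ?g {..<?g})"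
    by (blast intro: oneshot_steps_append oneshot_steps_single)
  moreover have "set ?fetch \<subseteq> fetch_steps ?G ?g"
    by (auto simp: fetch_steps_def inputs_trap)
  moreover have "greedy_choice rule ?G (p, {..<?g}) ?g"
    using assms weakly_preferred_linear[of rule ?G p ?g ?g]
    by (simp add: greedy_choice_def candidates_path)
  ultimately have "greedy_steps rule ?G (m + 1) init_config (ss @ (?fetch @ [Compute ?g]))
      (r(?g := Some Red), insert ?g {..<?g})"
    using run by (blast intro: greedy_steps_append greedy_steps_phase)
  moreover have "complete_config ?G (r(?g := Some Red), insert ?g {..<?g})"
    using assms pebbled by (simp add: complete_config_def sinks_trap r_def q_def)
  ultimately show ?thesis unfolding greedy_pebbling_def by blast
qed


section \<open>The optimal cost\<close>

text \<open>The last path node that uses \<open>b - m - 1\<close> is \<open>b - 1\<close>, so before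
  computing \<open>b\<close> that pebble can be deleted for free. The general set \<open>C\<close>
  and the last conjunct let the run resume after the trap node without losing its pebble.\<close>

lemma free_path_run:
  assumes "a \<le> b" "b \<le> 2 * m + 3" "reds p = {a - m - 1..<a}" "C \<inter> {a..<b} = {}"
  shows "\<exists>ss p'. oneshot_steps (trap m) (m + 1) (p, C) ss (p', C \<union> {a..<b}) \<and> cost ss = 0 \<and>
    reds p' = {b - m - 1..<b} \<and> (\<forall>u. u \<notin> {a - m - 1..<b} \<longrightarrow> p' u = p u)"
  using assms
proof (induction b rule: dec_induct)
  case base
  then show ?case
    by (intro exI[of _ "[]"] exI[of _ p]) (auto intro: steps_Nil)
next
  case (step b)
  then obtain ss q where run: "oneshot_steps (trap m) (m + 1) (p, C) ss (q, C \<union> {a..<b})"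
    and cost: "cost ss = 0" and red: "reds q = {b - m - 1..<b}"
    and same: "\<forall>u. u \<notin> {a - m - 1..<b} \<longrightarrow> q u = p u"
    by fastforce
  let ?G = "trap m" and ?D = "C \<union> {a..<b}"
  define evict where "evict = (if m < b then [Delete (b - m - 1)] else [])"
  define q' where "q' = (if m < b then q(b - m - 1 := None) else q)"
  have red': "reds q' = {b - m..<b}"
  proof (cases "m < b")
    case True
    then have "reds q' = {b - m - 1..<b} - {b - m - 1}"
      by (simp add: q'_def reds_upd red)
    also have "\<dots> = {b - m..<b}"
      using True by auto
    finally show ?thesis .
  qed (use red in \<open>simp add: q'_def\<close>)
  have "q (b - m - 1) \<noteq> None" if "m < b"
  proof -
    have "b - m - 1 \<in> reds q" using that by (simp add: red del: mem_reds)
    then show ?thesis by simp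
  qed
  then have "oneshot_steps ?G (m + 1) (q, ?D) evict (q', ?D)"
    by (auto simp: evict_def q'_def intro!: oneshot_steps_single oneshot_step.delete steps_Nil)
  moreover have "oneshot_step ?G (m + 1) (q', ?D) (Compute b) (q'(b := Some Red), insert b ?D)"
  proof (rule oneshot_step.compute)
    show "\<forall>u\<in>inputs ?G b. q' u = Some Red"
      using step.prems by (auto simp: inputs_path reds_eq_iff[OF red'])
    show "within_capacity (m + 1) (q'(b := Some Red))"
      by (simp add: within_capacity_reds reds_upd red')
  qed (use step.prems step.hyps in auto)
  moreover have "insert b ?D = C \<union> {a..<Suc b}"
    using step.hyps by auto
  ultimately have "oneshot_steps ?G (m + 1) (p, C) (ss @ evict @ [Compute b])
      (q'(b := Some Red), C \<union> {a..<Suc b})"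
    using run by (metis oneshot_steps_append oneshot_steps_single)
  moreover have "cost (ss @ evict @ [Compute b]) = 0"
    using cost by (simp add: evict_def)
  moreover have "reds (q'(b := Some Red)) = {Suc b - m - 1..<Suc b}"
    unfolding reds_upd red' by auto
  moreover have "\<forall>u. u \<notin> {a - m - 1..<Suc b} \<longrightarrow> (q'(b := Some Red)) u = p u"
    using same step.hyps by (auto simp: q'_def)
  ultimately show ?case by blast
qed

text \<open>The trap node is computed as soon as it becomes available, at the price of storing and
  reloading only the nodes \<open>0\<close> and \<open>2\<close> and storing the trap node itself.\<close>

lemma ex_cheap_pebbling:
  assumes "2 \<le> m"
  shows "\<exists>ss. pebbling (trap m) (m + 1) ss \<and> cost ss = 5"
proof -
  let ?G = "trap m" and ?g = "2 * m + 3" and ?C = "{..<m + 2}"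
  obtain ss1 p1 where run1: "oneshot_steps ?G (m + 1) init_config ss1 (p1, {..<m + 1})"
    and cost1: "cost ss1 = 0" and red1: "reds p1 = {..<m + 1}"
  proof -
    have "reds (\<lambda>_. None :: pebble option) = {0 - m - 1..<0 :: nat}"
      by (simp add: reds_def)
    from free_path_run[OF _ _ this, of "m + 1" "{}"] show thesis
      using that by (auto simp: init_config_def atLeast0LessThan)
  qed
  \<comment> \<open>The five charged steps are storing 0, 2 and the trap node and loading 0 and 2.
    Node 0 makes room for \<open>m + 1\<close>; afterwards 1 has no further use and is deleted,
    whereas 2 is still an input of \<open>m + 2\<close> and must come back.\<close>
  define p2 where "p2 = (p1(0 := Some Blue))(m + 1 := Some Red)"
  define p3 where "p3 = ((p2(1 := None))(2 := Some Blue))(0 := Some Red)"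
  define p4 where "p4 = p3(?g := Some Red)"
  define p5 where "p5 = ((p4(?g := Some Blue))(0 := None))(2 := Some Red)"
  define p6 where "p6 = p5(m + 2 := Some Red)"
  have red2: "reds p2 = {1..m + 1}"
    unfolding p2_def reds_upd red1 by auto
  have red3: "reds p3 = insert 0 {3..m + 1}"
    unfolding p3_def reds_upd red2 by auto
  have red4: "reds p4 = insert ?g (reds p3)"
    by (simp add: p4_def reds_upd)
  have red5: "reds p5 = {2..m + 1}"
    unfolding p5_def reds_upd red4 red3 using assms by auto
  have red6: "reds p6 = {m + 3 - m - 1..<m + 3}"
    unfolding p6_def reds_upd red5 by auto
  have run2: "oneshot_steps ?G (m + 1) (p1, {..<m + 1}) [Store 0, Compute (m + 1)] (p2, ?C)"
  proof (rule steps_Cons)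
    show "oneshot_step ?G (m + 1) (p1, {..<m + 1}) (Store 0) (p1(0 := Some Blue), {..<m + 1})"
      by (auto intro!: oneshot_step.store simp: reds_eq_iff[OF red1])
    have "oneshot_step ?G (m + 1) (p1(0 := Some Blue), {..<m + 1}) (Compute (m + 1))
        (p2, insert (m + 1) {..<m + 1})"
      unfolding p2_def
    proof (rule oneshot_step.compute)
      show "\<forall>u\<in>inputs ?G (m + 1). (p1(0 := Some Blue)) u = Some Red"
        by (auto simp: inputs_path reds_eq_iff[OF red1])
      show "within_capacity (m + 1) ((p1(0 := Some Blue))(m + 1 := Some Red))"
        using red2 by (simp add: within_capacity_reds p2_def)
    qed auto
    moreover have "insert (m + 1) {..<m + 1} = ?C" by auto
    ultimately show "oneshot_steps ?G (m + 1) (p1(0 := Some Blue), {..<m + 1}) [Compute (m + 1)] (p2, ?C)"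
      by (metis oneshot_steps_single)
  qed
  have p2: "p2 0 = Some Blue" "p2 1 = Some Red" "p2 2 = Some Red"
    using assms by (auto simp: reds_eq_iff[OF red2]) (simp add: p2_def)
  have run3: "oneshot_steps ?G (m + 1) (p2, ?C) [Delete 1, Store 2, Load 0] (p3, ?C)"
    unfolding p3_def
  proof (intro steps_Cons)
    show "oneshot_step ?G (m + 1) (p2, ?C) (Delete 1) (p2(1 := None), ?C)"
      using p2 by (intro oneshot_step.delete) simp
    show "oneshot_step ?G (m + 1) (p2(1 := None), ?C) (Store 2) ((p2(1 := None))(2 := Some Blue), ?C)"
      using p2 by (intro oneshot_step.store) simp
    show "oneshot_step ?G (m + 1) ((p2(1 := None))(2 := Some Blue), ?C) (Load 0)
        (((p2(1 := None))(2 := Some Blue))(0 := Some Red), ?C)"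
      using p2 red3 assms by (intro oneshot_step.load) (simp_all add: within_capacity_reds p3_def)
  qed (rule steps_Nil)
  have run4: "oneshot_steps ?G (m + 1) (p3, ?C) [Compute ?g] (p4, insert ?g ?C)"
    unfolding p4_def
  proof (intro oneshot_steps_single oneshot_step.compute)
    show "\<forall>u\<in>inputs ?G ?g. p3 u = Some Red"
      by (auto simp: inputs_trap reds_eq_iff[OF red3])
    show "within_capacity (m + 1) (p3(?g := Some Red))"
      using red3 assms by (simp add: within_capacity_reds reds_upd card_insert_if)
  qed auto
  have p4: "p4 ?g = Some Red" "p4 0 = Some Red" "p4 2 = Some Blue"
    using assms by (simp_all add: p4_def p3_def)
  have run5: "oneshot_steps ?G (m + 1) (p4, insert ?g ?C) [Store ?g, Delete 0, Load 2] (p5, insert ?g ?C)"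
    unfolding p5_def
  proof (intro steps_Cons)
    let ?D = "insert ?g ?C"
    show "oneshot_step ?G (m + 1) (p4, ?D) (Store ?g) (p4(?g := Some Blue), ?D)"
      using p4 by (intro oneshot_step.store) simp
    show "oneshot_step ?G (m + 1) (p4(?g := Some Blue), ?D) (Delete 0) ((p4(?g := Some Blue))(0 := None), ?D)"
      using p4 by (intro oneshot_step.delete) simp
    show "oneshot_step ?G (m + 1) ((p4(?g := Some Blue))(0 := None), ?D) (Load 2)
        (((p4(?g := Some Blue))(0 := None))(2 := Some Red), ?D)"
      using p4 red5 assms by (intro oneshot_step.load) (simp_all add: within_capacity_reds p5_def)
  qed (rule steps_Nil)
  have run6: "oneshot_steps ?G (m + 1) (p5, insert ?g ?C) [Compute (m + 2)] (p6, insert (m + 2) (insert ?g ?C))"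
    unfolding p6_def
  proof (intro oneshot_steps_single oneshot_step.compute)
    show "\<forall>u\<in>inputs ?G (m + 2). p5 u = Some Red"
      by (auto simp: inputs_path reds_eq_iff[OF red5])
    show "within_capacity (m + 1) (p5(m + 2 := Some Red))"
      using red5 by (simp add: within_capacity_reds reds_upd)
  qed (use assms in auto)
  obtain ss7 p7 C7 where
    run7: "oneshot_steps ?G (m + 1) (p6, insert (m + 2) (insert ?g ?C)) ss7 (p7, C7)"
    and cost7: "cost ss7 = 0" and red7: "reds p7 = {?g - m - 1..<?g}"
    and same7: "\<forall>u. u \<notin> {m + 3 - m - 1..<?g} \<longrightarrow> p7 u = p6 u"
  proof -
    have "insert (m + 2) (insert ?g ?C) \<inter> {m + 3..<?g} = {}" by auto
    from free_path_run[OF _ _ red6 this] show thesis using that by auto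
  qed
  let ?ss = "ss1 @ [Store 0, Compute (m + 1)] @ [Delete 1, Store 2, Load 0] @ [Compute ?g] @
    [Store ?g, Delete 0, Load 2] @ [Compute (m + 2)] @ ss7"
  have "oneshot_steps ?G (m + 1) init_config ?ss (p7, C7)"
    by (rule run1 run2 run3 run4 run5 run6 run7 oneshot_steps_append)+
  \<comment> \<open>The final run changes only nodes below \<open>?g\<close>, so the blue pebble on
    this sink survives.\<close>
  moreover have "p7 ?g \<noteq> None"
    using same7 assms by (simp add: p6_def p5_def)
  moreover have "2 * m + 2 \<in> reds p7"
    unfolding red7 by simp
  then have "p7 (2 * m + 2) \<noteq> None" by simp
  ultimately have "pebbling ?G (m + 1) ?ss"
    using assms by (auto simp: pebbling_def complete_config_def sinks_trap)
  moreover have "cost ?ss = 5"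
    by (simp add: cost1 cost7)
  ultimately show ?thesis by blast
qed

text \<open>Computing \<open>m + 1\<close> forces the red pebble off \<open>0\<close>; without stores it is lost for good.\<close>

lemma free_steps_miss_trap:
  assumes "oneshot_steps (trap m) (m + 1) c ss c'" "cost ss = 0" "2 \<le> m"
    and "{u. fst c u \<noteq> None} \<subseteq> snd c" "finite (snd c)" "\<forall>u. fst c u \<noteq> Some Blue"
    and "1 \<in> snd c \<longrightarrow> 0 \<in> snd c" "m + 1 \<in> snd c \<longrightarrow> 0 \<in> snd c \<and> fst c 0 = None"
    and "2 * m + 3 \<notin> snd c"
  shows "2 * m + 3 \<notin> snd c'"
  using assms
proof (induction rule: oneshot_steps.induct)
  case (steps_Cons c s c' ss c'')
  have cost: "cost ss = 0" "step_cost s = 0" using steps_Cons.prems by simp_all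
  have peb: "{u. fst c' u \<noteq> None} \<subseteq> snd c' \<and> finite (snd c')"
    using steps_Cons.prems
    by (intro oneshot_steps_pebbled_computed[OF oneshot_steps_single[OF steps_Cons.hyps(1)]])
  from steps_Cons.hyps(1) show ?case
  proof cases
    case (compute v C p)
    have red: "u \<in> C" if "u \<in> inputs (trap m) v" for u
      using that compute steps_Cons.prems by auto
    \<comment> \<open>Its inputs include both \<open>m + 1\<close> and 0, but the invariant leaves 0
      empty once \<open>m + 1\<close> is computed.\<close>
    have "v \<noteq> 2 * m + 3"
    proof
      assume v: "v = 2 * m + 3"
      then have "m + 1 \<in> C" "p 0 = Some Red"
        using red[of "m + 1"] compute \<open>2 \<le> m\<close> by (auto simp: inputs_trap)
      then show False using compute steps_Cons.prems by auto
    qed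
    moreover have "0 \<in> C" if "v = 1"
      using red[of 0] that \<open>2 \<le> m\<close> by (auto simp: inputs_path)
    moreover have "0 \<in> C \<and> p 0 = None" if v: "v = m + 1"
    proof
      \<comment> \<open>Node 0 is not an input of \<open>m + 1\<close>; that it was computed follows
        through node 1.\<close>
      show "0 \<in> C"
      proof -
        have "1 \<in> inputs (trap m) v" using v \<open>2 \<le> m\<close> by (simp add: inputs_path)
        then have "1 \<in> C" by (rule red)
        then show ?thesis using compute steps_Cons.prems by simp
      qed
      have fin: "finite (reds (fst c'))"
        using peb finite_reds by blast
      have "reds (fst c') = insert v (inputs (trap m) v)"
      proof (rule reds_after_Compute)
        show "oneshot_step (trap m) (m + 1) (fst c, snd c) (Compute v) (fst c', snd c')"
          using steps_Cons.hyps(1) compute by simp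
        show "m + 1 \<le> card (insert v (inputs (trap m) v))"
          using v by (simp add: inputs_path)
      qed (rule fin)
      then have "0 \<notin> reds (fst c')"
        using v by (auto simp: inputs_path)
      then have "p 0 \<noteq> Some Red"
        using compute v by auto
      moreover have "p 0 \<noteq> Some Blue"
        using compute steps_Cons.prems by auto
      ultimately show "p 0 = None"
        by (metis (full_types) not_None_eq pebble.exhaust)
    qed
    \<comment> \<open>The one-shot rule: a lost pebble on 0 cannot be recomputed.\<close>
    moreover have "v \<noteq> 0" if "0 \<in> C"
      using that \<open>v \<notin> C\<close> by metis
    ultimately show ?thesis
      using compute steps_Cons.prems peb cost by (intro steps_Cons.IH) auto
  next
    case (delete p v C)
    then show ?thesis
      using steps_Cons.prems peb cost by (intro steps_Cons.IH) auto
  qed (use cost in auto)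
qed simp

text \<open>A nonempty set of naturals attains its infimum, so an optimum of 0 would come from a
  free pebbling, which cannot reach the trap sink.\<close>

lemma opt_trap:
  assumes "2 \<le> m"
  shows "0 < opt (trap m) (m + 1)" "opt (trap m) (m + 1) \<le> 5"
proof -
  let ?costs = "{cost ss |ss. pebbling (trap m) (m + 1) ss}"
  have 5: "5 \<in> ?costs"
    using ex_cheap_pebbling[OF assms] by force
  then show "opt (trap m) (m + 1) \<le> 5"
    unfolding opt_def by (intro cInf_lower) auto
  from 5 have "opt (trap m) (m + 1) \<in> ?costs"
    unfolding opt_def by (intro Inf_nat_def1) blast
  then obtain ss c where "cost ss = opt (trap m) (m + 1)"
    and run: "oneshot_steps (trap m) (m + 1) init_config ss c"
    and "complete_config (trap m) c"
    by (auto simp: pebbling_def)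
  moreover have "2 * m + 3 \<in> snd c"
  proof -
    have "fst c (2 * m + 3) \<noteq> None"
      using \<open>complete_config (trap m) c\<close> assms by (simp add: complete_config_def sinks_trap)
    then show ?thesis
      using oneshot_steps_pebbled_computed[OF run] by (auto simp: init_config_def)
  qed
  ultimately show "0 < opt (trap m) (m + 1)"
    using free_steps_miss_trap[OF run _ assms] by (auto simp: init_config_def intro: gr0I)
qed

section \<open>The family of DAGs and the comparison with the square root of the number of
  nodes\<close>

theorem theorem8p1:
  shows "\<exists>(\<G> :: nat pair_pre_digraph set) (R :: nat pair_pre_digraph \<Rightarrow> nat) (f :: nat \<Rightarrow> real).
    (\<forall>G \<in> \<G>. dag G) \<and>
    (\<forall>N. \<exists>G \<in> \<G>. N \<le> card (pverts G)) \<and>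
    f \<in> soft_Theta (\<lambda>n. sqrt (real n)) \<and>
    (\<forall>G \<in> \<G>. 0 < opt G (R G) \<and>
      (\<forall>rule.
        (\<exists>ss. greedy_pebbling rule G (R G) ss) \<and>
        (\<forall>ss. greedy_pebbling rule G (R G) ss \<longrightarrow>
          f (card (pverts G)) * real (opt G (R G)) \<le> real (cost ss))))"
proof (intro exI conjI)
  \<comment> \<open>As \<open>trap m\<close> has \<open>2 * m + 4\<close> nodes, \<open>?R\<close>
    recovers \<open>m + 1\<close> from the graph. The square root itself serves as \<open>f\<close>,
    with logarithmic exponent 0.\<close>
  let ?\<G> = "trap ` {60..}" and ?R = "\<lambda>G :: nat pair_pre_digraph. card (pverts G) div 2 - 1"
  let ?f = "\<lambda>n. sqrt (real n)"
  show "\<forall>G \<in> ?\<G>. dag G"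
    by (auto intro: dag_trap)
  show "\<forall>N. \<exists>G \<in> ?\<G>. N \<le> card (pverts G)"
  proof
    fix N
    have "trap (N + 60) \<in> ?\<G>" "N \<le> card (pverts (trap (N + 60)))" by auto
    then show "\<exists>G \<in> ?\<G>. N \<le> card (pverts G)" by blast
  qed
  show "?f \<in> soft_Theta ?f"
    by (auto simp: soft_Theta_def intro!: exI[of _ 0])
  show "\<forall>G \<in> ?\<G>. 0 < opt G (?R G) \<and> (\<forall>rule. (\<exists>ss. greedy_pebbling rule G (?R G) ss) \<and>
    (\<forall>ss. greedy_pebbling rule G (?R G) ss \<longrightarrow>
      ?f (card (pverts G)) * real (opt G (?R G)) \<le> real (cost ss)))"
  proof (intro ballI)
    fix G assume "G \<in> ?\<G>"
    then obtain m where G: "G = trap m" and m: "60 \<le> m" by auto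
    have R: "?R G = m + 1" by (simp add: G)
    have bound: "?f (card (pverts G)) * real (opt G (m + 1)) \<le> real (cost ss)"
      if "greedy_pebbling rule G (m + 1) ss" for rule ss
    proof -
      have "?f (card (pverts G)) \<le> real m / 5"
      proof (rule real_le_lsqrt)
        \<comment> \<open>This is \<open>25 * (2 * m + 4) \<le> m * m\<close>, the squared form of
          the bound that absorbs the factor 5 from the optimum; for \<open>m \<ge> 60\<close> it
          follows from \<open>60 * m \<le> m * m\<close>.\<close>
        have "50 * real m + 100 \<le> real m * real m"
          using m mult_right_mono[of 60 "real m" "real m"] by linarith
        then show "real (card (pverts G)) \<le> (real m / 5)\<^sup>2"
          by (simp add: G power2_eq_square field_simps)
      qed simp
      then have "?f (card (pverts G)) * real (opt G (m + 1)) \<le> real m / 5 * 5"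
        using opt_trap(2)[of m] m by (intro mult_mono) (auto simp: G)
      also have "\<dots> \<le> real (cost ss)"
        using greedy_cost_ge[of rule m ss] that m by (simp add: G)
      finally show ?thesis .
    qed
    show "0 < opt G (?R G) \<and> (\<forall>rule. (\<exists>ss. greedy_pebbling rule G (?R G) ss) \<and>
      (\<forall>ss. greedy_pebbling rule G (?R G) ss \<longrightarrow>
        ?f (card (pverts G)) * real (opt G (?R G)) \<le> real (cost ss)))"
      unfolding R using bound opt_trap(1)[of m] ex_greedy_pebbling[of m] m by (simp add: G)
  qed
qed

end
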